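(* Let $1\le k\le n$, let $b_1>b_2>\ldots>b_k>0$ and $b=(b_1,\ldots,b_k)$, and let $A,H\in\mathfrak{g}_n$ be two symmetric matrices sharing the same ordered eigen-directions. Then $Q_{A,b}:\mathscr{F}_{n,k}\to\mathbb{R}$ is a strict Lyapunov function for the flow $\varphi_H^t:\mathscr{F}_{n,k}\to\mathscr{F}_{n,k}$. (The statement holds in each of the two contexts, special linear and symplectic, described in the context.)
   Context: Two contexts. (1) Special linear: $\mathfrak{g}_n=\mathrm{sl}(n,\mathbb{R})$ is the Lie algebra of real traceless $n\times n$ matrices, $N=n$, and $\mathscr{F}_{n,k}$ is the manifold of all $k$-flags in $\mathbb{R}^n$, i.e. sequences $V_\ast=(V_1,\ldots,V_k)$ of linear subspaces $V_1\subset V_2\subset\ldots\subset V_k\subset\mathbb{R}^n$ with $\dim V_i=i$. (2) Symplectic: $\mathfrak{g}_n=\mathrm{sp}(n,\mathbb{R})$ is the Lie algebra of the group $\mathrm{Sp}(n,\mathbb{R})$ of real $2n\times 2n$ matrices $M$ with $M^tJM=J$, where $J=\begin{pmatrix}0&-I\\ I&0\end{pmatrix}$, $N=2n$, and $\mathscr{F}_{n,k}$ is the manifold of all isotropic $k$-flags in $\mathbb{R}^{2n}$, i.e. $k$-flags $(V_1,\ldots,V_k)$ in $\mathbb{R}^{2n}$ with $\dim V_i=i$ and $u^tJv=0$ for all $u,v\in V_k$. Flow: for $H\in\mathfrak{g}_n$, $\varphi_H^t(V_1,\ldots,V_k)=(e^{tH}V_1,\ldots,e^{tH}V_k)$. Function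 $Q_{A,b}$: given $V_\ast\in\mathscr{F}_{n,k}$ choose $v_1\in V_1$ with $\|v_1\|=b_1$ and, for $2\le i\le k$, $v_i\in V_i\cap V_{i-1}^\perp$ with $\|v_i\|=b_i$; then $Q_{A,b}(V_\ast)=\frac1k\sum_{i=1}^k\langle Av_i,v_i\rangle$ (independent of the choices). Two symmetric matrices $A,H\in\mathfrak{g}_n$ share the same ordered eigen-directions iff there is a common basis of eigenvectors $v_1,\ldots,v_N$ of $\mathbb{R}^N$, $Av_i=\lambda_i(A)v_i$, $Hv_i=\lambda_i(H)v_i$, such that $\lambda_i(A)>\lambda_j(A)\Leftrightarrow\lambda_i(H)>\lambda_j(H)$ for all $i,j=1,\ldots,N$. A function $Q:\mathscr{F}\to\mathbb{R}$ is a Lyapunov function for a flow $\varphi^t$ on $\mathscr{F}$ iff $Q(\varphi^t(x))\ge Q(x)$ for all $x\in\mathscr{F}$, $t\ge0$; it is a strict Lyapunov function if moreover $Q(\varphi^t(x))=Q(x)\Leftrightarrow\varphi^t(x)=x$ for every $x\in\mathscr{F}$ and $t>0$. *)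

theory Defs
  imports "HOL-Analysis.Analysis"
begin

definition mat_pow :: "real^'n^'n \<Rightarrow> nat \<Rightarrow> real^'n^'n" where
  "mat_pow X m = ((**) X ^^ m) (mat 1)"

definition mat_exp :: "real^'n^'n \<Rightarrow> real^'n^'n" where
  "mat_exp X = (\<Sum>m. (1 / fact m) *\<^sub>R mat_pow X m)"

definition sl_algebra :: "(real^'n^'n) set" where
  "sl_algebra = {X. trace X = 0}"

text \<open>The space \<open>\<real>\<^sup>2\<^sup>n\<close> is indexed by the sum type \<open>'n + 'n\<close>; \<open>Inl\<close> and \<open>Inr\<close> mark the
  first and the second block of \<open>n\<close> coordinates.\<close>

definition symp_J :: "real^('n + 'n)^('n::finite + 'n)" where
  "symp_J = (\<chi> r c. case (r, c) of
      (Inl i, Inr j) \<Rightarrow> if i = j then -1 else 0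
    | (Inr i, Inl j) \<Rightarrow> if i = j then 1 else 0
    | _ \<Rightarrow> 0)"

definition Sp_group :: "(real^('n + 'n)^('n::finite + 'n)) set" where
  "Sp_group = {M. transpose M ** symp_J ** M = symp_J}"

text \<open>The Lie algebra of a closed matrix group consists of the generators of its
  one-parameter subgroups.\<close>

definition matrix_lie_algebra :: "(real^'n^'n) set \<Rightarrow> (real^'n^'n) set" where
  "matrix_lie_algebra G = {X. \<forall>t::real. mat_exp (t *\<^sub>R X) \<in> G}"

definition sp_algebra :: "(real^('n + 'n)^('n::finite + 'n)) set" where
  "sp_algebra = matrix_lie_algebra Sp_group"

text \<open>A flag \<open>(V\<^sub>1, \<dots>, V\<^sub>k)\<close> is a list of length \<open>k\<close>; list positions start at 0, so
  position \<open>i\<close> holds the subspace of dimension \<open>i + 1\<close>.\<close>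

definition flags :: "nat \<Rightarrow> (real^'n) set list set" where
  "flags k = {V. length V = k \<and>
     (\<forall>i<k. subspace (V ! i) \<and> dim (V ! i) = i + 1) \<and>
     (\<forall>i. i + 1 < k \<longrightarrow> V ! i \<subset> V ! (i + 1))}"

definition isotropic_flags :: "nat \<Rightarrow> (real^('n::finite + 'n)) set list set" where
  "isotropic_flags k = {V \<in> flags k. \<forall>u\<in>last V. \<forall>v\<in>last V. u \<bullet> (symp_J *v v) = 0}"

definition flag_flow :: "real^'n^'n \<Rightarrow> real \<Rightarrow> (real^'n) set list \<Rightarrow> (real^'n) set list" where
  "flag_flow H t V = map (\<lambda>W. (*v) (mat_exp (t *\<^sub>R H)) ` W) V"

definition adapted_frame :: "real list \<Rightarrow> (real^'n) set list \<Rightarrow> (real^'n) list \<Rightarrow> bool" where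
  "adapted_frame b V v \<longleftrightarrow> length v = length V \<and>
     (\<forall>i<length V. v ! i \<in> V ! i \<and> norm (v ! i) = b ! i \<and>
        (0 < i \<longrightarrow> v ! i \<in> orthogonal_comp (V ! (i - 1))))"

definition frame_average :: "real^'n^'n \<Rightarrow> (real^'n) list \<Rightarrow> real" where
  "frame_average A v = (\<Sum>i<length v. (A *v (v ! i)) \<bullet> (v ! i)) / real (length v)"

definition Q_fun :: "real^'n^'n \<Rightarrow> real list \<Rightarrow> (real^'n) set list \<Rightarrow> real" where
  "Q_fun A b V = frame_average A (SOME v. adapted_frame b V v)"

definition same_ordered_eigendirections :: "real^'n^'n \<Rightarrow> real^'n^'n \<Rightarrow> bool" where
  "same_ordered_eigendirections A H \<longleftrightarrow>
     (\<exists>(v :: 'n \<Rightarrow> real^'n) (\<alpha> :: 'n \<Rightarrow> real) (\<eta> :: 'n \<Rightarrow> real).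
        inj v \<and> independent (range v) \<and> span (range v) = UNIV \<and>
        (\<forall>i. A *v v i = \<alpha> i *\<^sub>R v i \<and> H *v v i = \<eta> i *\<^sub>R v i) \<and>
        (\<forall>i j. \<alpha> i > \<alpha> j \<longleftrightarrow> \<eta> i > \<eta> j))"

definition lyapunov_function :: "'x set \<Rightarrow> (real \<Rightarrow> 'x \<Rightarrow> 'x) \<Rightarrow> ('x \<Rightarrow> real) \<Rightarrow> bool" where
  "lyapunov_function F \<phi> Q \<longleftrightarrow> (\<forall>x\<in>F. \<forall>t\<ge>0. Q (\<phi> t x) \<ge> Q x)"

definition strict_lyapunov_function :: "'x set \<Rightarrow> (real \<Rightarrow> 'x \<Rightarrow> 'x) \<Rightarrow> ('x \<Rightarrow> real) \<Rightarrow> bool" where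
  "strict_lyapunov_function F \<phi> Q \<longleftrightarrow> lyapunov_function F \<phi> Q \<and>
     (\<forall>x\<in>F. \<forall>t>0. Q (\<phi> t x) = Q x \<longleftrightarrow> \<phi> t x = x)"

text \<open>The exponential series converges and its sum is a one-parameter group.\<close>

lemma mat_pow_0 [simp]: "mat_pow X 0 = mat 1"
  by (simp add: mat_pow_def)

lemma mat_pow_Suc: "mat_pow X (Suc m) = X ** mat_pow X m"
  by (simp add: mat_pow_def)

lemma mat_pow_add: "mat_pow X (m + n) = mat_pow X m ** mat_pow X n"
  by (induction m) (simp_all add: mat_pow_Suc matrix_mul_assoc)

lemma mat_pow_scaleR: "mat_pow (c *\<^sub>R X) m = c ^ m *\<^sub>R mat_pow X m"
  by (induction m)
    (simp_all add: mat_pow_Suc matrix_scalar_ac scalar_matrix_assoc[symmetric])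

lemma mat_pow_entry_bound:
  fixes X :: "real^'n^'n"
  shows "\<bar>mat_pow X m $ i $ j\<bar> \<le> (\<Sum>a\<in>UNIV. \<Sum>b\<in>UNIV. \<bar>X $ a $ b\<bar>) ^ m"
proof (induction m arbitrary: i)
  case 0
  show ?case by (simp add: mat_def)
next
  case (Suc m)
  define c where "c = (\<Sum>a\<in>UNIV. \<Sum>b\<in>UNIV. \<bar>X $ a $ b\<bar>)"
  have c0: "0 \<le> c"
    unfolding c_def by (intro sum_nonneg) auto
  have "\<bar>mat_pow X (Suc m) $ i $ j\<bar> = \<bar>\<Sum>k\<in>UNIV. X $ i $ k * mat_pow X m $ k $ j\<bar>"
    by (simp add: mat_pow_Suc matrix_matrix_mult_def)
  also have "\<dots> \<le> (\<Sum>k\<in>UNIV. \<bar>X $ i $ k\<bar> * \<bar>mat_pow X m $ k $ j\<bar>)"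
    by (rule order_trans[OF sum_abs]) (simp add: abs_mult)
  also have "\<dots> \<le> (\<Sum>k\<in>UNIV. \<bar>X $ i $ k\<bar> * c ^ m)"
    using Suc.IH by (intro sum_mono mult_left_mono) (auto simp: c_def)
  also have "\<dots> = (\<Sum>k\<in>UNIV. \<bar>X $ i $ k\<bar>) * c ^ m"
    by (simp add: sum_distrib_right)
  also have "\<dots> \<le> c * c ^ m"
  proof (intro mult_right_mono)
    show "(\<Sum>k\<in>UNIV. \<bar>X $ i $ k\<bar>) \<le> c"
      unfolding c_def by (rule member_le_sum) (auto intro: sum_nonneg)
  qed (use c0 in auto)
  finally show ?case by (simp add: c_def)
qed

lemma mat_exp_entry_summable:
  fixes X :: "real^'n^'n"
  shows "summable (\<lambda>m. norm (mat_pow X m $ i $ j / fact m))"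
proof (rule summable_comparison_test)
  define c where "c = (\<Sum>a\<in>UNIV. \<Sum>b\<in>UNIV. \<bar>X $ a $ b\<bar>)"
  show "summable (\<lambda>m. inverse (fact m) * c ^ m)"
    by (rule summable_exp)
  show "\<exists>N. \<forall>m\<ge>N. norm (norm (mat_pow X m $ i $ j / fact m)) \<le> inverse (fact m) * c ^ m"
    using mat_pow_entry_bound[of X _ i j]
    by (auto simp: c_def abs_mult divide_inverse mult.commute intro!: mult_left_mono)
qed

lemma mat_exp_sums:
  fixes X :: "real^'n^'n"
  shows "(\<lambda>m. (1 / fact m) *\<^sub>R mat_pow X m) sums
           (\<chi> i j. \<Sum>m. mat_pow X m $ i $ j / fact m)"
  unfolding sums_def
proof (intro vec_tendstoI)
  fix i j
  have "(\<lambda>m. mat_pow X m $ i $ j / fact m) sums (\<Sum>m. mat_pow X m $ i $ j / fact m)"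
    using mat_exp_entry_summable[of X i j] by (intro summable_sums) (rule summable_norm_cancel)
  then show "(\<lambda>n. (\<Sum>m<n. (1 / fact m) *\<^sub>R mat_pow X m) $ i $ j) \<longlonglongrightarrow>
      (\<chi> i j. \<Sum>m. mat_pow X m $ i $ j / fact m) $ i $ j"
    by (simp add: sums_def)
qed

lemma mat_exp_summable: "summable (\<lambda>m. (1 / fact m) *\<^sub>R mat_pow X m)"
  for X :: "real^'n^'n"
  using mat_exp_sums by (rule sums_summable)

lemma mat_exp_nth: "mat_exp X $ i $ j = (\<Sum>m. mat_pow X m $ i $ j / fact m)"
  for X :: "real^'n^'n"
  unfolding mat_exp_def mat_exp_sums[of X, THEN sums_unique, symmetric] by simp

lemma mat_exp_0: "mat_exp (0 *\<^sub>R X) = mat 1"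
proof -
  have "mat_exp (0 *\<^sub>R X) $ i $ j = mat 1 $ i $ j" for i j
  proof -
    have "(\<Sum>m. mat_pow (0 *\<^sub>R X) m $ i $ j / fact m)
        = (\<Sum>m\<in>{0}. mat_pow (0 *\<^sub>R X) m $ i $ j / fact m)"
      by (rule suminf_finite) (auto simp: mat_pow_scaleR simp del: scaleR_zero_left)
    then show ?thesis by (simp add: mat_exp_nth)
  qed
  then show ?thesis by (simp add: vec_eq_iff)
qed

lemma mat_exp_add: "mat_exp ((s + t) *\<^sub>R X) = mat_exp (s *\<^sub>R X) ** mat_exp (t *\<^sub>R X)"
proof -
  have "(mat_exp (s *\<^sub>R X) ** mat_exp (t *\<^sub>R X)) $ a $ b = mat_exp ((s + t) *\<^sub>R X) $ a $ b" for a b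
  proof -
    let ?P = "\<lambda>r i a b. mat_pow (r *\<^sub>R X) i $ a $ b / fact i"
    have "(\<lambda>m. \<Sum>i\<le>m. ?P s i a k * ?P t (m - i) k b) sums ((\<Sum>m. ?P s m a k) * (\<Sum>m. ?P t m k b))"
      for k
      by (intro Cauchy_product_sums mat_exp_entry_summable)
    then have "(\<lambda>m. \<Sum>k\<in>UNIV. \<Sum>i\<le>m. ?P s i a k * ?P t (m - i) k b) sums
        (\<Sum>k\<in>UNIV. (\<Sum>m. ?P s m a k) * (\<Sum>m. ?P t m k b))"
      by (intro sums_sum)
    moreover have "(\<Sum>k\<in>UNIV. \<Sum>i\<le>m. ?P s i a k * ?P t (m - i) k b) = ?P (s + t) m a b" for m
    proof -
      have "(\<Sum>k\<in>UNIV. \<Sum>i\<le>m. ?P s i a k * ?P t (m - i) k b)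
          = (\<Sum>i\<le>m. \<Sum>k\<in>UNIV. ?P s i a k * ?P t (m - i) k b)"
        by (rule sum.swap)
      also have "\<dots> = (\<Sum>i\<le>m. s ^ i * t ^ (m - i) / (fact i * fact (m - i)) *
          (mat_pow X i ** mat_pow X (m - i)) $ a $ b)"
        by (simp add: mat_pow_scaleR matrix_matrix_mult_def sum_distrib_left field_simps)
      also have "\<dots> = (\<Sum>i\<le>m. of_nat (m choose i) * s ^ i * t ^ (m - i) * (mat_pow X m $ a $ b / fact m))"
        by (intro sum.cong refl) (simp add: binomial_fact flip: mat_pow_add)
      also have "\<dots> = ?P (s + t) m a b"
        by (simp add: mat_pow_scaleR binomial_ring sum_distrib_right sum_divide_distrib)
      finally show ?thesis .
    qed
    ultimately show ?thesis
      by (simp add: mat_exp_nth matrix_matrix_mult_def sums_iff)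
  qed
  then show ?thesis by (simp add: vec_eq_iff)
qed

lemma mat_exp_inverse: "mat_exp (t *\<^sub>R X) ** mat_exp (- t *\<^sub>R X) = mat 1"
  using mat_exp_add[of t "- t" X] by (simp add: mat_exp_0[of X, simplified])

lemma inj_mat_exp: "inj ((*v) (mat_exp (t *\<^sub>R X)))"
proof (rule inj_on_inverseI)
  show "mat_exp (- t *\<^sub>R X) *v (mat_exp (t *\<^sub>R X) *v x) = x" for x
    using mat_exp_inverse[of "- t" X] by (simp add: matrix_vector_mul_assoc)
qed

text \<open>The flow is a one-parameter group of self-maps of the flag manifolds.\<close>

lemma flag_flow_0: "flag_flow H 0 V = V"
  by (simp add: flag_flow_def mat_exp_0[of H, simplified])

lemma flag_flow_add: "flag_flow H (s + t) V = flag_flow H s (flag_flow H t V)"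
  by (simp add: flag_flow_def mat_exp_add image_image matrix_vector_mul_assoc)

lemma flag_flow_flags:
  assumes "V \<in> flags k"
  shows "flag_flow H t V \<in> flags k"
proof -
  let ?f = "(*v) (mat_exp (t *\<^sub>R H))"
  have lin: "linear ?f" by simp
  have dim: "dim (?f ` W) = dim W" for W
    by (rule dim_image_eq[OF lin]) (rule inj_on_subset[OF inj_mat_exp subset_UNIV])
  have psub: "?f ` W \<subset> ?f ` W'" if "W \<subset> W'" for W W'
    using that inj_image_subset_iff[OF inj_mat_exp[of t H]] by (simp add: less_le_not_le)
  show ?thesis
    using assms psub unfolding flags_def flag_flow_def
    by (auto simp: dim linear_subspace_image[OF lin])
qed

lemma flag_flow_isotropic_flags:
  assumes "1 \<le> k" and "H \<in> sp_algebra" and V: "V \<in> isotropic_flags k"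
  shows "flag_flow H t V \<in> isotropic_flags k"
proof -
  let ?M = "mat_exp (t *\<^sub>R H)"
  have M: "transpose ?M ** symp_J ** ?M = symp_J"
    using assms(2) by (simp add: sp_algebra_def matrix_lie_algebra_def Sp_group_def)
  have "V \<noteq> []"
    using assms by (auto simp: isotropic_flags_def flags_def)
  then have last: "last (flag_flow H t V) = (*v) ?M ` last V"
    by (simp add: flag_flow_def last_map)
  have "(?M *v u) \<bullet> (symp_J *v (?M *v v)) = u \<bullet> (symp_J *v v)" for u v
  proof -
    have "(?M *v u) \<bullet> (symp_J *v (?M *v v)) = u \<bullet> (transpose ?M *v (symp_J *v (?M *v v)))"
      by (simp only: dot_lmul_matrix[symmetric] vector_transpose_matrix)
    also have "\<dots> = u \<bullet> ((transpose ?M ** symp_J ** ?M) *v v)"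
      by (simp only: matrix_vector_mul_assoc matrix_mul_assoc)
    finally show ?thesis by (simp only: M)
  qed
  then show ?thesis
    using V flag_flow_flags unfolding isotropic_flags_def by (auto simp: last)
qed

text \<open>Adapted frames exist, and the average does not depend on the frame chosen.\<close>

lemma flag_line:
  assumes V: "V \<in> flags k" and i: "i < k"
  obtains e where "norm e = 1"
    "{x \<in> V ! i. 0 < i \<longrightarrow> x \<in> orthogonal_comp (V ! (i - 1))} = span {e}"
proof -
  let ?L = "{x \<in> V ! i. 0 < i \<longrightarrow> x \<in> orthogonal_comp (V ! (i - 1))}"
  have sub: "subspace (V ! j)" and dim: "dim (V ! j) = j + 1" if "j < k" for j
    using V that by (auto simp: flags_def)
  have L: "subspace ?L"
  proof (cases i)
    case 0
    then show ?thesis using sub[OF i] by simp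
  next
    case (Suc j)
    then have "?L = V ! i \<inter> orthogonal_comp (V ! (i - 1))" by auto
    then show ?thesis
      by (simp add: subspace_inter sub[OF i] subspace_orthogonal_comp)
  qed
  have "dim ?L = 1"
  proof (cases i)
    case 0
    then show ?thesis using dim[OF i] by simp
  next
    case (Suc j)
    then have j: "j < k" and sub_ji: "V ! j \<subseteq> V ! i"
      using V i by (auto simp: flags_def)
    have "dim {y \<in> V ! i. \<forall>x\<in>V ! j. orthogonal x y} + dim (V ! j) = dim (V ! i)"
      by (rule dim_subspace_orthogonal_to_vectors) (use sub j i sub_ji in auto)
    moreover have "{y \<in> V ! i. \<forall>x\<in>V ! j. orthogonal x y} = ?L"
      using Suc by (auto simp: orthogonal_comp_def)
    ultimately show ?thesis using dim[OF i] dim[OF j] Suc by simp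
  qed
  with L obtain B where B: "\<And>x. x \<in> B \<Longrightarrow> norm x = 1" "card B = 1" "span B = ?L"
    by (metis (no_types, lifting) orthonormal_basis_subspace)
  then obtain e where "B = {e}" by (metis card_1_singletonE)
  with B that show thesis by auto
qed

lemma ex_adapted_frame:
  assumes V: "V \<in> flags k" and b: "\<And>i. i < k \<Longrightarrow> 0 \<le> b ! i"
  shows "\<exists>v. adapted_frame b V v"
proof -
  have len: "length V = k" using V by (simp add: flags_def)
  have "\<exists>x. x \<in> V ! i \<and> norm x = b ! i \<and> (0 < i \<longrightarrow> x \<in> orthogonal_comp (V ! (i - 1)))"
    if i: "i < k" for i
  proof -
    obtain e where e: "norm e = 1"
      "{x \<in> V ! i. 0 < i \<longrightarrow> x \<in> orthogonal_comp (V ! (i - 1))} = span {e}"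
      using flag_line[OF V i] by blast
    have "b ! i *\<^sub>R e \<in> span {e}" by (simp add: span_base span_scale)
    then show ?thesis
      using e b[OF i] by (intro exI[of _ "b ! i *\<^sub>R e"]) auto
  qed
  then obtain f where f: "\<forall>i<k. f i \<in> V ! i \<and> norm (f i) = b ! i \<and>
      (0 < i \<longrightarrow> f i \<in> orthogonal_comp (V ! (i - 1)))"
    by metis
  then have "adapted_frame b V (map f [0..<k])"
    by (simp add: adapted_frame_def len)
  then show ?thesis by blast
qed

lemma frame_average_unique:
  assumes V: "V \<in> flags k" and v: "adapted_frame b V v" and w: "adapted_frame b V w"
  shows "frame_average A v = frame_average A w"
proof -
  have len: "length V = k" "length v = k" "length w = k"
    using V v w by (simp_all add: flags_def adapted_frame_def)
  have "w ! i = v ! i \<or> w ! i = - (v ! i)" if i: "i < k" for i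
  proof -
    obtain e where e: "norm e = 1"
      "{x \<in> V ! i. 0 < i \<longrightarrow> x \<in> orthogonal_comp (V ! (i - 1))} = span {e}"
      using flag_line[OF V i] by blast
    have "v ! i \<in> span {e}" "w ! i \<in> span {e}"
      using v w i len unfolding e(2)[symmetric] adapted_frame_def by auto
    then obtain p q where pq: "v ! i = p *\<^sub>R e" "w ! i = q *\<^sub>R e"
      by (auto simp: span_singleton)
    have "norm (v ! i) = norm (w ! i)"
      using v w i len by (simp add: adapted_frame_def)
    then have "\<bar>p\<bar> = \<bar>q\<bar>" by (simp add: pq e(1))
    then show ?thesis by (auto simp: pq abs_eq_iff)
  qed
  then have "(A *v (v ! i)) \<bullet> (v ! i) = (A *v (w ! i)) \<bullet> (w ! i)" if "i < k" for i
    using that by (metis (no_types) inner_minus_left inner_minus_right minus_minus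
        mult_minus1 scaleR_minus1_left matrix_vector_mult_scaleR)
  then show ?thesis by (simp add: frame_average_def len)
qed

lemma Q_fun_eq:
  assumes "V \<in> flags k" and "adapted_frame b V v"
  shows "Q_fun A b V = frame_average A v"
  unfolding Q_fun_def using assms by (metis frame_average_unique someI)

end

theory Submission
  imports Defs
begin

text \<open>
  Write \<open>P\<^sub>W\<close> for the orthogonal projection onto a subspace \<open>W\<close>. The vectors of an adapted frame of
  \<open>V\<close>, divided by their lengths, are orthonormal, and \<open>P\<close> of the \<open>i\<close>-th subspace differs from \<open>P\<close> of its
  predecessor by the projection onto the \<open>i\<close>-th of them. Summation by parts therefore turns the
  average into
  \<open>k Q(V) = \<Sum>i (b\<^sub>i\<^sup>2 - b\<^sub>i\<^sub>+\<^sub>1\<^sup>2) tr (A P)\<close>, where \<open>P\<close> projects onto the \<open>i\<close>-th subspace and the last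
  difference is \<open>b\<^sub>k\<^sup>2\<close>. As \<open>b\<close> decreases and is positive, all weights are positive
  (\<open>Q_fun_positive_combination\<close>), and it is enough to treat one subspace at a time: \<open>tr (A P\<^sub>W)\<close>
  must not decrease when \<open>W\<close> moves by \<open>exp (t H)\<close>, and may return to its initial value only if \<open>W\<close>
  did not move.

  For one subspace, the derivative of \<open>P\<close> along the flow is \<open>P H (1 - P) + (1 - P) H P\<close>. In an
  orthonormal basis \<open>B\<close> of common eigenvectors, with eigenvalues \<open>\<alpha>\<close> of \<open>A\<close> and \<open>\<eta>\<close> of \<open>H\<close>, this gives
  \<open>d/dt tr (A P) = \<Sum>b c. (\<alpha> b - \<alpha> c) (\<eta> b - \<eta> c) (P b \<bullet> c)\<^sup>2\<close>
  (\<open>compressed_trace_derivative\<close>). The eigenvalues are equally ordered, so every summand is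
  nonnegative. If the sum vanishes, then \<open>P b \<bullet> c = 0\<close> whenever \<open>\<eta> b \<noteq> \<eta> c\<close>; that is, \<open>P\<close> commutes with
  \<open>H\<close>, and \<open>W\<close> is invariant under the flow (\<open>velocity_zero_imp_invariant\<close>).

  The isotropic flags form a subset of all flags in \<open>\<real>\<^sup>2\<^sup>n\<close>, and the strict Lyapunov property
  restricts to subsets; so both contexts follow from one statement about symmetric matrices.
\<close>

section \<open>Orthogonal projections\<close>

definition oproj :: "'a::euclidean_space set \<Rightarrow> 'a \<Rightarrow> 'a" where
  "oproj W x = (SOME y. y \<in> W \<and> (\<forall>w\<in>W. (x - y) \<bullet> w = 0))"

lemma
  assumes "subspace W"
  shows oproj_in: "oproj W x \<in> W"
    and oproj_residual: "w \<in> W \<Longrightarrow> (x - oproj W x) \<bullet> w = 0"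
proof -
  obtain y z where "y \<in> span W" "\<And>w. w \<in> span W \<Longrightarrow> orthogonal z w" "x = y + z"
    using orthogonal_subspace_decomp_exists by blast
  then have "y \<in> W \<and> (\<forall>w\<in>W. (x - y) \<bullet> w = 0)"
    using assms by (simp add: orthogonal_def span_eq_iff[THEN iffD2])
  then have "oproj W x \<in> W \<and> (\<forall>w\<in>W. (x - oproj W x) \<bullet> w = 0)"
    unfolding oproj_def by (rule someI)
  then show "oproj W x \<in> W" "w \<in> W \<Longrightarrow> (x - oproj W x) \<bullet> w = 0" by auto
qed

lemma oproj_unique:
  assumes W: "subspace W" and y: "y \<in> W" "\<And>w. w \<in> W \<Longrightarrow> (x - y) \<bullet> w = 0"
  shows "oproj W x = y"
proof -
  let ?d = "oproj W x - y"
  have "?d \<in> W" by (simp add: W oproj_in subspace_diff y(1))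
  then have "(x - y) \<bullet> ?d - (x - oproj W x) \<bullet> ?d = 0"
    by (simp add: W oproj_residual y(2))
  then have "?d \<bullet> ?d = 0" by (simp add: algebra_simps)
  then show ?thesis by simp
qed

lemma oproj_ident: "subspace W \<Longrightarrow> x \<in> W \<Longrightarrow> oproj W x = x"
  by (rule oproj_unique) auto

lemma oproj_trivial: "oproj {0} x = 0"
  by (rule oproj_unique) auto

lemma oproj_inner_left:
  assumes "subspace W"
  shows "oproj W x \<bullet> oproj W y = x \<bullet> oproj W y"
  using oproj_residual[OF assms oproj_in[OF assms], of x y] by (simp add: inner_diff_left)

lemma oproj_symmetric:
  assumes "subspace W"
  shows "oproj W x \<bullet> y = x \<bullet> oproj W y"
  by (metis assms inner_commute oproj_inner_left)

lemma norm_oproj_le: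
  assumes "subspace W"
  shows "norm (oproj W x) \<le> norm x"
proof -
  have "norm (oproj W x) * norm (oproj W x) = x \<bullet> oproj W x"
    using oproj_inner_left[OF assms, of x x] by (simp add: power2_norm_eq_inner flip: power2_eq_square)
  also have "\<dots> \<le> norm x * norm (oproj W x)" by (rule norm_cauchy_schwarz)
  finally show ?thesis
    by (cases "norm (oproj W x) = 0") (auto simp: mult_le_cancel_right)
qed

text \<open>Adding a dimension to a subspace adds a rank-one projection. This is how a flag's adapted frame
  is recovered from the projections onto its members.\<close>

lemma oproj_extend:
  assumes U: "subspace U" and W: "subspace W" and UW: "U \<subseteq> W" and dim: "dim W = dim U + 1"
    and v: "v \<in> W" "\<And>u. u \<in> U \<Longrightarrow> v \<bullet> u = 0" "v \<noteq> 0"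
  shows "oproj W x = oproj U x + ((x \<bullet> v) / (v \<bullet> v)) *\<^sub>R v"
proof (rule oproj_unique[OF W])
  show "oproj U x + ((x \<bullet> v) / (v \<bullet> v)) *\<^sub>R v \<in> W"
    using oproj_in[OF U] UW v(1) W by (blast intro: subspace_add subspace_scale)
next
  fix w assume w: "w \<in> W"
  have "v \<notin> span U"
    using v U by (metis inner_eq_zero_iff span_eq_iff)
  then have "dim (insert v U) = dim W"
    by (simp add: dim dim_insert)
  then have "span (insert v U) = W"
    using UW v(1) W
    by (metis dim_eq_span insert_subset order_refl span_eq_iff)
  then obtain k where k: "w - k *\<^sub>R v \<in> U"
    using w U by (metis span_breakdown_eq span_eq_iff)
  let ?z = "x - (oproj U x + ((x \<bullet> v) / (v \<bullet> v)) *\<^sub>R v)"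
  have 1: "?z \<bullet> (w - k *\<^sub>R v) = 0"
    using oproj_residual[OF U k, of x] v(2)[OF k] by (simp add: inner_diff_left inner_add_left)
  have "oproj U x \<bullet> v = 0"
    using v(2)[OF oproj_in[OF U, of x]] by (simp only: inner_commute)
  then have "?z \<bullet> v = 0"
    using v(3) by (simp add: inner_diff_left inner_add_left)
  with 1 show "?z \<bullet> w = 0" by (simp add: inner_diff_right)
qed

section \<open>A subspace moved by the flow\<close>

text \<open>The functions \<open>\<alpha>\<close> and \<open>\<eta>\<close> stand for the eigenvalues of \<open>A\<close> and \<open>H\<close>. Together with the
  basis they determine both maps, which are therefore not part of the locale.\<close>

locale ordered_eigenbasis =
  fixes B :: "'a::euclidean_space set" and \<alpha> \<eta> :: "'a \<Rightarrow> real"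
  assumes orthogonal_B: "pairwise orthogonal B"
    and norm_B: "b \<in> B \<Longrightarrow> norm b = 1"
    and span_B: "span B = UNIV"
    and same_order: "b \<in> B \<Longrightarrow> c \<in> B \<Longrightarrow> \<alpha> c < \<alpha> b \<longleftrightarrow> \<eta> c < \<eta> b"
begin

definition flow :: "real \<Rightarrow> 'a \<Rightarrow> 'a" where
  "flow t x = (\<Sum>b\<in>B. (exp (t * \<eta> b) * (x \<bullet> b)) *\<^sub>R b)"

text \<open>The trace of \<open>A P\<^sub>W\<close>, or equally of the compression of \<open>A\<close> to \<open>W\<close>.\<close>

definition compressed_trace :: "'a set \<Rightarrow> real" where
  "compressed_trace W = (\<Sum>b\<in>B. \<alpha> b * (oproj W b \<bullet> b))"

text \<open>The derivative of \<^const>\<open>compressed_trace\<close> along the flow, symmetrized in \<open>b\<close> and \<open>c\<close> so that its sign is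
  visible. It equals the Frobenius inner product of the commutators \<open>[P\<^sub>W, A]\<close> and \<open>[P\<^sub>W, H]\<close>.\<close>

definition velocity :: "'a set \<Rightarrow> real" where
  "velocity W = (\<Sum>b\<in>B. \<Sum>c\<in>B. (\<alpha> b - \<alpha> c) * (\<eta> b - \<eta> c) * (oproj W b \<bullet> c)\<^sup>2)"

lemma finite_B: "finite B"
proof -
  have "0 \<notin> B" using norm_B by force
  then show ?thesis
    using orthogonal_B pairwise_orthogonal_independent independent_imp_finite by blast
qed

lemma inner_B: "b \<in> B \<Longrightarrow> c \<in> B \<Longrightarrow> b \<bullet> c = (if b = c then 1 else 0)"
  using orthogonal_B norm_B by (auto simp: pairwise_def orthogonal_def norm_eq_1)

lemma expand: "(\<Sum>b\<in>B. (x \<bullet> b) *\<^sub>R b) = x"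
  by (rule orthonormal_basis_expand) (simp_all add: orthogonal_B norm_B span_B finite_B)

lemma inner_expand: "x \<bullet> y = (\<Sum>b\<in>B. (x \<bullet> b) * (y \<bullet> b))"
proof -
  have "x \<bullet> y = (\<Sum>b\<in>B. (x \<bullet> b) *\<^sub>R b) \<bullet> y" by (simp only: expand)
  also have "\<dots> = (\<Sum>b\<in>B. (x \<bullet> b) * (b \<bullet> y))" by (simp add: inner_sum_left)
  finally show ?thesis by (simp only: inner_commute[of y])
qed

lemma eqI_coordinates: "(\<And>b. b \<in> B \<Longrightarrow> x \<bullet> b = y \<bullet> b) \<Longrightarrow> x = y"
  by (metis (mono_tags, lifting) expand sum.cong)

lemma flow_coordinate: "b \<in> B \<Longrightarrow> flow t x \<bullet> b = exp (t * \<eta> b) * (x \<bullet> b)"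
  by (simp add: flow_def inner_sum_left inner_B finite_B if_distrib cong: if_cong)

lemma linear_flow: "linear (flow t)"
  by (rule linearI; rule eqI_coordinates) (simp_all add: flow_coordinate inner_add_left algebra_simps)

lemma flow_0: "flow 0 x = x"
  by (rule eqI_coordinates) (simp add: flow_coordinate)

lemma flow_add: "flow (s + t) x = flow s (flow t x)"
  by (rule eqI_coordinates) (simp add: flow_coordinate distrib_right exp_add)

lemma flow_inverse: "flow (- t) (flow t x) = x"
  using flow_add[of "- t" t x] by (simp add: flow_0)

lemma flow_self_adjoint: "flow t x \<bullet> y = x \<bullet> flow t y"
  by (simp add: inner_expand[of "flow t x" y] inner_expand[of x "flow t y"] flow_coordinate algebra_simps)

lemma subspace_flow: "subspace W \<Longrightarrow> subspace (flow t ` W)"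
  by (rule linear_subspace_image[OF linear_flow])

text \<open>With \<open>D = exp (t H)\<close>, \<open>P'\<close> projects onto \<open>D W\<close>, so \<open>(1 - P') D P = 0\<close> and \<open>(1 - P) D\<^sup>-\<^sup>1 P' = 0\<close>. Hence
  \<open>P' - P = P' (1 - P) - (1 - P') P\<close> is equal to \<open>P' (1 - D\<^sup>-\<^sup>1) (1 - P) - (1 - P') (1 - D) P\<close>. Here each
  term contains a factor that is small with \<open>t\<close>, and the projections are bounded. Continuity
  and differentiability of the moving projection follow from this identity without any
  inversion of a Gram matrix.\<close>

lemma projection_change:
  fixes x y :: 'a and t :: real
  assumes W: "subspace W"
  defines "P \<equiv> oproj W" and "P' \<equiv> oproj (flow t ` W)"
  shows "P' x \<bullet> y - P x \<bullet> y =
      (\<Sum>c\<in>B. (P' x \<bullet> c) * ((1 - exp (- t * \<eta> c)) * ((y - P y) \<bullet> c))) -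
      (\<Sum>c\<in>B. ((x - P' x) \<bullet> c) * ((1 - exp (t * \<eta> c)) * (P y \<bullet> c)))"
proof -
  have W': "subspace (flow t ` W)" by (rule subspace_flow[OF W])
  let ?z = "y - P y"
  obtain w where w: "w \<in> W" "P' x = flow t w"
    using oproj_in[OF W', of x] unfolding P'_def by (rule imageE)
  have "P' x \<bullet> flow (- t) ?z = w \<bullet> ?z"
    by (simp only: w(2) flow_self_adjoint[of "- t", symmetric] flow_inverse)
  also have "\<dots> = 0"
    unfolding P_def using oproj_residual[OF W w(1)] by (simp only: inner_commute)
  finally have 1: "P' x \<bullet> flow (- t) ?z = 0" .
  have 2: "(x - P' x) \<bullet> flow t (P y) = 0"
    unfolding P_def P'_def by (rule oproj_residual[OF W']) (rule imageI, rule oproj_in[OF W])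
  have e: "u \<bullet> (v - flow s v) = (\<Sum>c\<in>B. (u \<bullet> c) * ((1 - exp (s * \<eta> c)) * (v \<bullet> c)))" for u v s
    unfolding inner_expand[of u "v - flow s v"]
    by (rule sum.cong[OF refl]) (simp add: inner_diff_left flow_coordinate left_diff_distrib)
  have "P' x \<bullet> y - P x \<bullet> y = P' x \<bullet> (?z - flow (- t) ?z) - (x - P' x) \<bullet> (P y - flow t (P y))"
    using 1 2 oproj_symmetric[OF W, of x y] unfolding P_def
    by (simp only: inner_diff_left inner_diff_right)
  then show ?thesis by (simp only: e)
qed

lemma projection_continuous:
  assumes W: "subspace W"
  shows "((\<lambda>t. oproj (flow t ` W) x \<bullet> y) \<longlongrightarrow> oproj W x \<bullet> y) (at 0)"
proof -
  let ?P' = "\<lambda>t. oproj (flow t ` W)"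
  have bdd: "norm (?P' t x) \<le> norm x" for t
    by (rule norm_oproj_le[OF subspace_flow[OF W]])
  have bounded_times_null: "((\<lambda>t. (u t \<bullet> c) * r t) \<longlongrightarrow> 0) (at 0)"
    if "\<And>t. norm (u t) \<le> K" "(r \<longlongrightarrow> 0) (at 0)" for u :: "real \<Rightarrow> 'a" and c r K
  proof (rule Lim_null_comparison)
    have "\<bar>u t \<bullet> c\<bar> \<le> K * norm c" for t
      using Cauchy_Schwarz_ineq2[of "u t" c] that(1)[of t]
      by (meson mult_right_mono norm_ge_zero order_trans)
    then show "\<forall>\<^sub>F t in at 0. norm ((u t \<bullet> c) * r t) \<le> (K * norm c) * \<bar>r t\<bar>"
      by (simp add: abs_mult mult_right_mono)
    show "((\<lambda>t. K * norm c * \<bar>r t\<bar>) \<longlongrightarrow> 0) (at 0)"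
      using that(2) by (intro tendsto_mult_right_zero tendsto_rabs_zero)
  qed
  have b2: "norm (x - ?P' t x) \<le> norm x + norm x" for t
    using bdd[of t] norm_triangle_ineq4[of x "?P' t x"] by linarith
  have lim1: "((\<lambda>t. (1 - exp (- t * h)) * k) \<longlongrightarrow> 0) (at 0)"
       "((\<lambda>t. (1 - exp (t * h)) * k) \<longlongrightarrow> 0) (at 0)" for h k :: real
  proof -
    have "((\<lambda>t. (1 - exp (- t * h)) * k) \<longlongrightarrow> (1 - exp (- 0 * h)) * k) (at 0)"
      "((\<lambda>t. (1 - exp (t * h)) * k) \<longlongrightarrow> (1 - exp (0 * h)) * k) (at 0)"
      by (intro tendsto_intros)+
    then show "((\<lambda>t. (1 - exp (- t * h)) * k) \<longlongrightarrow> 0) (at 0)"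
      "((\<lambda>t. (1 - exp (t * h)) * k) \<longlongrightarrow> 0) (at 0)" by simp_all
  qed
  have "((\<lambda>t. ?P' t x \<bullet> y - oproj W x \<bullet> y) \<longlongrightarrow> (\<Sum>c\<in>B. 0) - (\<Sum>c\<in>B. 0)) (at 0)"
    unfolding projection_change[OF W]
    by (intro tendsto_diff tendsto_sum bounded_times_null[OF bdd lim1(1)]
        bounded_times_null[OF b2 lim1(2)])
  then show ?thesis by (simp add: LIM_zero_iff)
qed

text \<open>Divide the identity of \<open>projection_change\<close> by \<open>t\<close>: the slopes of \<open>1 - exp (- t \<eta>)\<close> and
  \<open>1 - exp (t \<eta>)\<close> at \<open>0\<close> are \<open>\<eta>\<close> and \<open>- \<eta>\<close>. The result is \<open>P H (1 - P) + (1 - P) H P\<close> in coordinates.\<close>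

lemma projection_derivative:
  assumes W: "subspace W"
  shows "((\<lambda>t. oproj (flow t ` W) x \<bullet> y) has_real_derivative
      (\<Sum>c\<in>B. (oproj W x \<bullet> c) * (\<eta> c * ((y - oproj W y) \<bullet> c))) +
      (\<Sum>c\<in>B. ((x - oproj W x) \<bullet> c) * (\<eta> c * (oproj W y \<bullet> c)))) (at 0)"
proof -
  let ?P = "oproj W" and ?P' = "\<lambda>t. oproj (flow t ` W)"
  have slope: "((\<lambda>t. (1 - exp (t * h)) / t) \<longlongrightarrow> - h) (at 0)" for h :: real
  proof -
    have "((\<lambda>t. 1 - exp (t * h)) has_real_derivative - h) (at 0)"
      by (auto intro!: derivative_eq_intros)
    then show ?thesis by (simp add: DERIV_def)
  qed
  have "((\<lambda>t. (?P' t x \<bullet> y - ?P x \<bullet> y) / t) \<longlongrightarrow>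
      (\<Sum>c\<in>B. (?P x \<bullet> c) * (\<eta> c * ((y - ?P y) \<bullet> c))) -
      (\<Sum>c\<in>B. ((x - ?P x) \<bullet> c) * (- \<eta> c * (?P y \<bullet> c)))) (at 0)"
  proof -
    have eq: "(?P' t x \<bullet> y - ?P x \<bullet> y) / t =
      (\<Sum>c\<in>B. (?P' t x \<bullet> c) * ((1 - exp (t * - \<eta> c)) / t * ((y - ?P y) \<bullet> c))) -
      (\<Sum>c\<in>B. (x \<bullet> c - ?P' t x \<bullet> c) * ((1 - exp (t * \<eta> c)) / t * (?P y \<bullet> c)))" for t
      unfolding projection_change[OF W]
      by (simp add: diff_divide_distrib[of "sum _ _"] sum_divide_distrib inner_diff_left)
    have "((\<lambda>t. (\<Sum>c\<in>B. (?P' t x \<bullet> c) * ((1 - exp (t * - \<eta> c)) / t * ((y - ?P y) \<bullet> c))) -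
      (\<Sum>c\<in>B. (x \<bullet> c - ?P' t x \<bullet> c) * ((1 - exp (t * \<eta> c)) / t * (?P y \<bullet> c)))) \<longlongrightarrow>
       (\<Sum>c\<in>B. (?P x \<bullet> c) * (- (- \<eta> c) * ((y - ?P y) \<bullet> c))) -
      (\<Sum>c\<in>B. (x \<bullet> c - ?P x \<bullet> c) * (- \<eta> c * (?P y \<bullet> c)))) (at 0)"
      by (intro tendsto_diff tendsto_sum tendsto_mult slope projection_continuous[OF W] tendsto_const)
    then show ?thesis unfolding eq by (simp add: inner_diff_left)
  qed
  moreover have "flow 0 ` W = W" by (simp add: flow_0)
  ultimately show ?thesis by (simp add: DERIV_def sum_negf)
qed

lemma compressed_trace_derivative_0:
  assumes W: "subspace W"
  shows "((\<lambda>t. compressed_trace (flow t ` W)) has_real_derivative velocity W) (at 0)"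
proof -
  let ?p = "\<lambda>b c. oproj W b \<bullet> c"
  \<comment> \<open>The relation \<open>P\<^sup>2 = P\<close> turns the diagonal entry of \<open>P\<close> into a sum of squares, which makes the
    two parts of the derivative comparable.\<close>
  have diag: "(\<Sum>c\<in>B. ?p b c * (\<eta> c * ((b - oproj W b) \<bullet> c))) +
      (\<Sum>c\<in>B. ((b - oproj W b) \<bullet> c) * (\<eta> c * ?p b c)) =
      2 * (\<Sum>c\<in>B. (\<eta> b - \<eta> c) * (?p b c)\<^sup>2)" if b: "b \<in> B" for b
  proof -
    have "?p b b = (\<Sum>c\<in>B. (?p b c)\<^sup>2)"
      using oproj_inner_left[OF W, of b b] inner_expand[of "oproj W b" "oproj W b"]
      by (simp add: power2_eq_square inner_commute)
    then have *: "(\<Sum>c\<in>B. \<eta> c * ?p b c * (b \<bullet> c)) = \<eta> b * (\<Sum>c\<in>B. (?p b c)\<^sup>2)"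
      using b by (simp add: inner_B finite_B if_distrib cong: if_cong)
    have "(\<Sum>c\<in>B. ?p b c * (\<eta> c * ((b - oproj W b) \<bullet> c))) +
      (\<Sum>c\<in>B. ((b - oproj W b) \<bullet> c) * (\<eta> c * ?p b c)) =
      2 * ((\<Sum>c\<in>B. \<eta> c * ?p b c * (b \<bullet> c)) - (\<Sum>c\<in>B. \<eta> c * (?p b c)\<^sup>2))"
      by (simp add: sum_distrib_left inner_diff_left power2_eq_square algebra_simps
          flip: sum_subtractf sum.distrib)
    also have "\<dots> = 2 * (\<Sum>c\<in>B. (\<eta> b - \<eta> c) * (?p b c)\<^sup>2)"
      unfolding * by (simp add: sum_distrib_left left_diff_distrib sum_subtractf)
    finally show ?thesis .
  qed
  have "((\<lambda>t. compressed_trace (flow t ` W)) has_real_derivative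
      (\<Sum>b\<in>B. \<alpha> b * ((\<Sum>c\<in>B. ?p b c * (\<eta> c * ((b - oproj W b) \<bullet> c))) +
      (\<Sum>c\<in>B. ((b - oproj W b) \<bullet> c) * (\<eta> c * ?p b c))))) (at 0)"
    unfolding compressed_trace_def
    by (intro DERIV_sum DERIV_cmult projection_derivative[OF W])
  also have "(\<Sum>b\<in>B. \<alpha> b * ((\<Sum>c\<in>B. ?p b c * (\<eta> c * ((b - oproj W b) \<bullet> c))) +
      (\<Sum>c\<in>B. ((b - oproj W b) \<bullet> c) * (\<eta> c * ?p b c)))) =
      2 * (\<Sum>b\<in>B. \<Sum>c\<in>B. \<alpha> b * (\<eta> b - \<eta> c) * (?p b c)\<^sup>2)"
  proof -
    have "(\<Sum>b\<in>B. \<alpha> b * ((\<Sum>c\<in>B. ?p b c * (\<eta> c * ((b - oproj W b) \<bullet> c))) +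
        (\<Sum>c\<in>B. ((b - oproj W b) \<bullet> c) * (\<eta> c * ?p b c)))) =
        (\<Sum>b\<in>B. \<alpha> b * (2 * (\<Sum>c\<in>B. (\<eta> b - \<eta> c) * (?p b c)\<^sup>2)))"
      by (rule sum.cong[OF refl]) (simp only: diag)
    then show ?thesis by (simp add: sum_distrib_left mult_ac)
  qed
  also have "\<dots> = velocity W"
  proof -
    have sym: "?p c b = ?p b c" for b c
      by (metis W inner_commute oproj_symmetric)
    have "(\<Sum>b\<in>B. \<Sum>c\<in>B. \<alpha> b * (\<eta> b - \<eta> c) * (?p b c)\<^sup>2) =
        (\<Sum>b\<in>B. \<Sum>c\<in>B. \<alpha> c * (\<eta> c - \<eta> b) * (?p b c)\<^sup>2)"
      by (subst sum.swap) (simp add: sym)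
    then show ?thesis
      unfolding velocity_def
      by (simp add: algebra_simps sum.distrib sum_subtractf)
  qed
  finally show ?thesis .
qed

lemma compressed_trace_derivative:
  assumes W: "subspace W"
  shows "((\<lambda>t. compressed_trace (flow t ` W)) has_real_derivative velocity (flow s ` W)) (at s)"
proof -
  have "((\<lambda>h. compressed_trace (flow (h + s) ` W)) has_real_derivative velocity (flow s ` W)) (at 0)"
    using compressed_trace_derivative_0[OF subspace_flow[OF W, of s]]
    by (simp add: image_image flow_add)
  then show ?thesis
    using DERIV_shift[of "\<lambda>t. compressed_trace (flow t ` W)" "velocity (flow s ` W)" 0 s] by simp
qed

lemma velocity_summand_nonneg:
  assumes "b \<in> B" "c \<in> B"
  shows "0 \<le> (\<alpha> b - \<alpha> c) * (\<eta> b - \<eta> c) * (oproj W b \<bullet> c)\<^sup>2"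
proof -
  have "0 \<le> (\<alpha> b - \<alpha> c) * (\<eta> b - \<eta> c)"
    using same_order[of b c] same_order[of c b] assms
    by (cases "\<alpha> b" "\<alpha> c" rule: linorder_cases) (auto simp: zero_le_mult_iff)
  then show ?thesis by simp
qed

lemma velocity_nonneg: "0 \<le> velocity W"
  unfolding velocity_def by (intro sum_nonneg velocity_summand_nonneg)

text \<open>A sum of nonnegative terms vanishes only termwise, which makes the matrix of \<open>P\<^sub>W\<close> block-diagonal
  with respect to the eigenspaces of \<open>H\<close>. So the projection commutes with the flow, and the flow
  maps the range of the projection to itself.\<close>

lemma velocity_zero_imp_invariant:
  assumes W: "subspace W" and vel: "velocity W = 0"
  shows "flow t ` W = W"
proof -
  have p: "oproj W b \<bullet> c = 0" if b: "b \<in> B" and c: "c \<in> B" and ne: "\<eta> b \<noteq> \<eta> c" for b c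
  proof -
    have "(\<Sum>c\<in>B. (\<alpha> b - \<alpha> c) * (\<eta> b - \<eta> c) * (oproj W b \<bullet> c)\<^sup>2) = 0"
      using vel b unfolding velocity_def
      by (subst (asm) sum_nonneg_eq_0_iff)
        (auto simp: finite_B intro!: sum_nonneg velocity_summand_nonneg)
    then have "(\<alpha> b - \<alpha> c) * (\<eta> b - \<eta> c) * (oproj W b \<bullet> c)\<^sup>2 = 0"
      using b c by (subst (asm) sum_nonneg_eq_0_iff) (auto simp: finite_B velocity_summand_nonneg)
    moreover have "\<alpha> b \<noteq> \<alpha> c"
      using ne same_order[OF b c] same_order[OF c b] by auto
    ultimately show ?thesis using ne by simp
  qed
  have comm: "flow s (oproj W x) = oproj W (flow s x)" for s x
  proof (rule eqI_coordinates)
    fix b assume b: "b \<in> B"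
    have "(\<Sum>c\<in>B. exp (s * \<eta> b) * (x \<bullet> c) * (oproj W b \<bullet> c)) =
        (\<Sum>c\<in>B. exp (s * \<eta> c) * (x \<bullet> c) * (oproj W b \<bullet> c))"
    proof (rule sum.cong[OF refl])
      fix c assume "c \<in> B"
      then show "exp (s * \<eta> b) * (x \<bullet> c) * (oproj W b \<bullet> c) = exp (s * \<eta> c) * (x \<bullet> c) * (oproj W b \<bullet> c)"
        using p[OF b] by (cases "\<eta> b = \<eta> c") auto
    qed
    moreover have "flow s (oproj W x) \<bullet> b = (\<Sum>c\<in>B. exp (s * \<eta> b) * (x \<bullet> c) * (oproj W b \<bullet> c))"
      using b by (simp add: flow_coordinate oproj_symmetric[OF W, of x] inner_expand[of x "oproj W b"]
          sum_distrib_left mult.assoc)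
    moreover have "oproj W (flow s x) \<bullet> b = (\<Sum>c\<in>B. exp (s * \<eta> c) * (x \<bullet> c) * (oproj W b \<bullet> c))"
      by (simp add: oproj_symmetric[OF W, of "flow s x"] inner_expand[of "flow s x" "oproj W b"] flow_coordinate)
    ultimately show "flow s (oproj W x) \<bullet> b = oproj W (flow s x) \<bullet> b"
      by simp
  qed
  have into: "flow s w \<in> W" if "w \<in> W" for s w
    using comm[of s w] oproj_in[OF W, of "flow s w"] oproj_ident[OF W that] by simp
  show ?thesis
  proof
    show "flow t ` W \<subseteq> W" using into by auto
    show "W \<subseteq> flow t ` W"
    proof
      fix w assume "w \<in> W"
      then have "flow (- t) w \<in> W" by (rule into)
      moreover have "flow t (flow (- t) w) = w" using flow_inverse[of "- t" w] by simp
      ultimately show "w \<in> flow t ` W" by force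
    qed
  qed
qed

lemma compressed_trace_mono:
  assumes W: "subspace W" and "s \<le> t"
  shows "compressed_trace (flow s ` W) \<le> compressed_trace (flow t ` W)"
  by (rule DERIV_nonneg_imp_nondecreasing[OF \<open>s \<le> t\<close>])
    (use compressed_trace_derivative[OF W] velocity_nonneg in blast)

lemma compressed_trace_le_flow:
  assumes "subspace W" "0 \<le> t"
  shows "compressed_trace W \<le> compressed_trace (flow t ` W)"
  using compressed_trace_mono[OF assms] by (simp add: flow_0)

text \<open>A positive velocity at time \<open>0\<close> produces a strict gain within a short time, and by
  monotonicity that gain is never lost. A return to the initial value thus forces the initial
  velocity to be zero.\<close>

lemma compressed_trace_eq_imp_invariant:
  assumes W: "subspace W" and t: "0 < t" and eq: "compressed_trace (flow t ` W) = compressed_trace W"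
  shows "flow t ` W = W"
proof (rule velocity_zero_imp_invariant[OF W], rule ccontr)
  assume "velocity W \<noteq> 0"
  then have "0 < velocity W" using velocity_nonneg[of W] by linarith
  with compressed_trace_derivative_0[OF W] obtain d where
    d: "0 < d" "\<And>h. 0 < h \<Longrightarrow> h < d \<Longrightarrow> compressed_trace (flow 0 ` W) < compressed_trace (flow (0 + h) ` W)"
    using DERIV_pos_inc_right by blast
  define h where "h = min t (d / 2)"
  have h: "0 < h" "h < d" "h \<le> t" using d(1) t by (auto simp: h_def)
  have "compressed_trace W < compressed_trace (flow h ` W)"
    using d(2)[OF h(1,2)] by (simp add: flow_0)
  also have "\<dots> \<le> compressed_trace (flow t ` W)"
    by (rule compressed_trace_mono[OF W h(3)])
  finally show False using eq by simp
qed

lemma diagonal_quadratic_form: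
  assumes f: "linear f" and diag: "\<And>b. b \<in> B \<Longrightarrow> f b = \<alpha> b *\<^sub>R b"
  shows "f x \<bullet> x = (\<Sum>b\<in>B. \<alpha> b * (x \<bullet> b)\<^sup>2)"
proof -
  have "f x = (\<Sum>b\<in>B. (x \<bullet> b) *\<^sub>R f b)"
    by (subst expand[of x, symmetric]) (simp only: linear_sum[OF f] linear_scale[OF f])
  also have "\<dots> = (\<Sum>b\<in>B. (x \<bullet> b * \<alpha> b) *\<^sub>R b)"
    by (simp add: diag)
  finally have "f x \<bullet> x = (\<Sum>b\<in>B. (x \<bullet> b * \<alpha> b) *\<^sub>R b) \<bullet> x" by (rule arg_cong)
  also have "\<dots> = (\<Sum>b\<in>B. (x \<bullet> b * \<alpha> b) * (b \<bullet> x))" by (simp add: inner_sum_left)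
  finally show ?thesis
    by (simp add: power2_eq_square inner_commute mult_ac)
qed

text \<open>By \<open>oproj_extend\<close>, the trace over \<open>W\<close> exceeds the trace over \<open>U\<close> by the Rayleigh quotient at the new
  direction. For \<open>v\<close> in an adapted frame, \<open>v \<bullet> v\<close> is the square of the prescribed length.\<close>

lemma compressed_trace_extend:
  assumes f: "linear f" "\<And>b. b \<in> B \<Longrightarrow> f b = \<alpha> b *\<^sub>R b"
    and UW: "subspace U" "subspace W" "U \<subseteq> W" "dim W = dim U + 1"
    and v: "v \<in> W" "\<And>u. u \<in> U \<Longrightarrow> v \<bullet> u = 0" "v \<noteq> 0"
  shows "(v \<bullet> v) * (compressed_trace W - compressed_trace U) = f v \<bullet> v"
proof -
  have "compressed_trace W - compressed_trace U = (\<Sum>b\<in>B. \<alpha> b * ((v \<bullet> b)\<^sup>2 / (v \<bullet> v)))"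
    unfolding compressed_trace_def sum_subtractf[symmetric]
  proof (rule sum.cong[OF refl])
    fix b
    have "oproj W b \<bullet> b = oproj U b \<bullet> b + (v \<bullet> b)\<^sup>2 / (v \<bullet> v)"
      by (simp add: oproj_extend[OF UW v] inner_add_left power2_eq_square inner_commute[of b v])
    then show "\<alpha> b * (oproj W b \<bullet> b) - \<alpha> b * (oproj U b \<bullet> b) = \<alpha> b * ((v \<bullet> b)\<^sup>2 / (v \<bullet> v))"
      by (simp add: algebra_simps)
  qed
  then show ?thesis
    using v(3) by (simp add: diagonal_quadratic_form[OF f] sum_distrib_left)
qed

lemma compressed_trace_trivial: "compressed_trace {0} = 0"
  by (simp add: compressed_trace_def oproj_trivial)

end

section \<open>Common eigenbases of matrices\<close>

lemma mat_exp_eigenvector: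
  fixes X :: "real^'n^'n"
  assumes "X *v x = l *\<^sub>R x"
  shows "mat_exp X *v x = exp l *\<^sub>R x"
proof -
  have pow: "mat_pow X m *v x = l ^ m *\<^sub>R x" for m
    by (induction m)
      (simp_all add: mat_pow_Suc assms matrix_vector_mult_scaleR mult.commute flip: matrix_vector_mul_assoc)
  have "linear (\<lambda>M::real^'n^'n. M *v x)"
    by (rule linearI) (simp_all add: matrix_vector_mult_add_rdistrib scaleR_matrix_vector_assoc)
  then have "bounded_linear (\<lambda>M::real^'n^'n. M *v x)"
    by (simp add: linear_conv_bounded_linear)
  then have "(\<lambda>m. ((1 / fact m) *\<^sub>R mat_pow X m) *v x) sums (mat_exp X *v x)"
    unfolding mat_exp_def by (rule bounded_linear.sums) (rule summable_sums[OF mat_exp_summable])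
  moreover have "((1 / fact m) *\<^sub>R mat_pow X m) *v x = (l ^ m /\<^sub>R fact m) *\<^sub>R x" for m
    by (simp add: pow divide_inverse flip: scaleR_matrix_vector_assoc)
  moreover have "(\<lambda>m. (l ^ m /\<^sub>R fact m) *\<^sub>R x) sums (exp l *\<^sub>R x)"
    by (rule bounded_linear.sums[OF bounded_linear_scaleR_left exp_converges])
  ultimately show ?thesis by (simp add: sums_unique2)
qed

locale common_eigenbasis = ordered_eigenbasis B \<alpha> \<eta>
  for B :: "(real^'n) set" and \<alpha> \<eta> +
  fixes A H :: "real^'n^'n"
  assumes A_eigen: "b \<in> B \<Longrightarrow> A *v b = \<alpha> b *\<^sub>R b"
    and H_eigen: "b \<in> B \<Longrightarrow> H *v b = \<eta> b *\<^sub>R b"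

lemma symmetric_matrix_inner:
  fixes A :: "real^'n^'n"
  assumes "transpose A = A"
  shows "(A *v x) \<bullet> y = x \<bullet> (A *v y)"
  by (metis assms dot_lmul_matrix vector_transpose_matrix)

text \<open>The given eigenbasis need not be orthogonal. Because the orders agree, \<open>\<eta>\<^sub>0\<close> is constant where \<open>\<alpha>\<^sub>0\<close> is,
  so \<open>H\<close> acts as a scalar on each eigenspace of \<open>A\<close> and any orthonormal basis of that eigenspace
  consists of eigenvectors of both matrices. Different eigenspaces of \<open>A\<close> are orthogonal by symmetry.\<close>

lemma ex_common_eigenbasis:
  fixes A H :: "real^'n^'n"
  assumes sym: "transpose A = A" and same: "same_ordered_eigendirections A H"
  obtains B \<alpha> \<eta> where "common_eigenbasis B \<alpha> \<eta> A H"
proof -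
  obtain v :: "'n \<Rightarrow> real^'n" and \<alpha>\<^sub>0 \<eta>\<^sub>0 where span_v: "span (range v) = UNIV"
    and v: "\<And>i. A *v v i = \<alpha>\<^sub>0 i *\<^sub>R v i" "\<And>i. H *v v i = \<eta>\<^sub>0 i *\<^sub>R v i"
    and order: "\<And>i j. \<alpha>\<^sub>0 i > \<alpha>\<^sub>0 j \<longleftrightarrow> \<eta>\<^sub>0 i > \<eta>\<^sub>0 j"
    using same unfolding same_ordered_eigendirections_def by metis
  define E where "E i = span (v ` {j. \<alpha>\<^sub>0 j = \<alpha>\<^sub>0 i})" for i
  have E: "A *v x = \<alpha>\<^sub>0 i *\<^sub>R x \<and> H *v x = \<eta>\<^sub>0 i *\<^sub>R x" if "x \<in> E i" for x i
    using that unfolding E_def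
  proof (induction rule: span_induct)
    case base
    show ?case
      by (auto simp: subspace_def matrix_vector_right_distrib matrix_vector_mult_scaleR scaleR_add_right)
  next
    case (step x)
    then obtain j where j: "x = v j" "\<alpha>\<^sub>0 j = \<alpha>\<^sub>0 i" by blast
    then have "\<eta>\<^sub>0 j = \<eta>\<^sub>0 i"
      using order[of i j] order[of j i] by linarith
    with v[of j] show ?case by (simp only: j simp_thms)
  qed
  have "\<exists>C. C \<subseteq> E i \<and> pairwise orthogonal C \<and> (\<forall>x\<in>C. norm x = 1) \<and> span C = E i" for i
  proof -
    have "subspace (E i)" by (simp add: E_def)
    then show ?thesis by (rule orthonormal_basis_subspace) blast
  qed
  then have ex: "\<exists>C. C \<subseteq> U \<and> pairwise orthogonal C \<and> (\<forall>x\<in>C. norm x = 1) \<and> span C = U"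
    if "U \<in> range E" for U
    using that by auto
  \<comment> \<open>The basis is chosen per eigenspace and not per index \<open>i\<close>: indices with equal eigenvalues must
    yield the same basis for the union below to be orthogonal.\<close>
  define C where "C U = (SOME C. C \<subseteq> U \<and> pairwise orthogonal C \<and> (\<forall>x\<in>C. norm x = 1) \<and> span C = U)"
    for U :: "(real^'n) set"
  have "C U \<subseteq> U \<and> pairwise orthogonal (C U) \<and> (\<forall>x\<in>C U. norm x = 1) \<and> span (C U) = U"
    if "U \<in> range E" for U
    unfolding C_def by (rule someI_ex[OF ex[OF that]])
  then have C: "C (E i) \<subseteq> E i" "pairwise orthogonal (C (E i))"
    "x \<in> C (E i) \<Longrightarrow> norm x = 1" "span (C (E i)) = E i" for i x
    by auto
  define B where "B = (\<Union>i. C (E i))"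
  \<comment> \<open>On a unit eigenvector the Rayleigh quotient is the eigenvalue.\<close>
  define \<alpha> where "\<alpha> b = (A *v b) \<bullet> b" for b
  define \<eta> where "\<eta> b = (H *v b) \<bullet> b" for b
  have Bi: "A *v b = \<alpha>\<^sub>0 i *\<^sub>R b" "H *v b = \<eta>\<^sub>0 i *\<^sub>R b" "\<alpha> b = \<alpha>\<^sub>0 i" "\<eta> b = \<eta>\<^sub>0 i"
    if "b \<in> C (E i)" for b i
  proof -
    have "b \<in> E i" using C(1) that by blast
    then show eig: "A *v b = \<alpha>\<^sub>0 i *\<^sub>R b" "H *v b = \<eta>\<^sub>0 i *\<^sub>R b" using E by auto
    have "b \<bullet> b = 1" using C(3)[OF that] by (simp add: norm_eq_1)
    then show "\<alpha> b = \<alpha>\<^sub>0 i" "\<eta> b = \<eta>\<^sub>0 i" by (simp_all add: \<alpha>_def \<eta>_def eig)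
  qed
  have "common_eigenbasis B \<alpha> \<eta> A H"
  proof
    show "pairwise orthogonal B"
    proof (rule pairwiseI)
      fix b c assume "b \<in> B" "c \<in> B" "b \<noteq> c"
      then obtain i j where ij: "b \<in> C (E i)" "c \<in> C (E j)" by (auto simp: B_def)
      show "orthogonal b c"
      proof (cases "\<alpha>\<^sub>0 i = \<alpha>\<^sub>0 j")
        case True
        then have "E i = E j" by (simp add: E_def)
        then show ?thesis
          using ij C(2)[of i] \<open>b \<noteq> c\<close> by (simp add: pairwise_def)
      next
        case False
        have "\<alpha>\<^sub>0 i * (b \<bullet> c) = \<alpha>\<^sub>0 j * (b \<bullet> c)"
          using symmetric_matrix_inner[OF sym, of b c] by (simp add: Bi(1)[OF ij(1)] Bi(1)[OF ij(2)])
        with False show ?thesis by (simp add: orthogonal_def)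
      qed
    qed
    show "span B = UNIV"
    proof -
      have "v i \<in> span B" for i
      proof -
        have "v i \<in> E i" by (auto simp: E_def intro: span_base)
        then have "v i \<in> span (C (E i))" by (simp only: C(4))
        moreover have "span (C (E i)) \<subseteq> span B"
          by (rule span_mono) (auto simp: B_def)
        ultimately show ?thesis by blast
      qed
      then have "span (range v) \<subseteq> span B" by (intro span_minimal) auto
      then show ?thesis by (simp add: span_v top.extremum_unique)
    qed
    show "norm b = 1" if "b \<in> B" for b
      using that C(3) by (auto simp: B_def)
    show "\<alpha> c < \<alpha> b \<longleftrightarrow> \<eta> c < \<eta> b" if bc: "b \<in> B" "c \<in> B" for b c
    proof -
      obtain i j where "b \<in> C (E i)" "c \<in> C (E j)" using bc unfolding B_def by blast
      then show ?thesis using order[of j i] by (simp only: Bi(3,4))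
    qed
    show "A *v b = \<alpha> b *\<^sub>R b" "H *v b = \<eta> b *\<^sub>R b" if b: "b \<in> B" for b
    proof -
      obtain i where "b \<in> C (E i)" using b unfolding B_def by blast
      from Bi[OF this] show "A *v b = \<alpha> b *\<^sub>R b" "H *v b = \<eta> b *\<^sub>R b" by simp_all
    qed
  qed
  then show thesis by (rule that)
qed

section \<open>Flags\<close>

text \<open>The boundary value below \<open>T 0\<close> is \<open>0\<close>, the trace over the zero subspace that precedes the first
  member of a flag; \<open>w\<close> is continued by \<open>0\<close> beyond \<open>n\<close>.\<close>

lemma summation_by_parts:
  fixes w T :: "nat \<Rightarrow> real"
  shows "(\<Sum>i<Suc n. w i * (T i - (if i = 0 then 0 else T (i - 1)))) =
    (\<Sum>i<Suc n. (w i - (if i < n then w (Suc i) else 0)) * T i)"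
proof -
  have "(\<Sum>i<Suc n. w i * (T i - (if i = 0 then 0 else T (i - 1)))) =
      (\<Sum>i<n. (w i - w (Suc i)) * T i) + w n * T n"
    by (induction n) (simp_all add: algebra_simps)
  then show ?thesis by simp
qed

context common_eigenbasis
begin

lemma mat_exp_eq_flow: "mat_exp (t *\<^sub>R H) *v x = flow t x"
proof -
  have "mat_exp (t *\<^sub>R H) *v x = (\<Sum>b\<in>B. (x \<bullet> b) *\<^sub>R (mat_exp (t *\<^sub>R H) *v b))"
    by (subst expand[of x, symmetric])
      (simp only: linear_sum[OF matrix_vector_mul_linear] matrix_vector_mult_scaleR)
  also have "\<dots> = flow t x"
    unfolding flow_def
  proof (rule sum.cong[OF refl])
    fix b assume "b \<in> B"
    then have "(t *\<^sub>R H) *v b = (t * \<eta> b) *\<^sub>R b"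
      by (simp add: H_eigen flip: scaleR_matrix_vector_assoc)
    from mat_exp_eigenvector[OF this]
    show "(x \<bullet> b) *\<^sub>R (mat_exp (t *\<^sub>R H) *v b) = (exp (t * \<eta> b) * (x \<bullet> b)) *\<^sub>R b"
      by (simp add: mult.commute)
  qed
  finally show ?thesis .
qed

lemma flag_flow_eq_flow: "flag_flow H t V = map ((`) (flow t)) V"
  by (simp add: flag_flow_def mat_exp_eq_flow)

text \<open>Each frame vector contributes its squared length times the increment of the trace between
  consecutive members of the flag. Summation by parts moves the differences to the squared
  lengths, where the monotonicity of \<open>b\<close> makes them positive. The weights do not depend on the
  flag, so they are the same before and after the motion.\<close>

lemma Q_fun_positive_combination:
  assumes k: "1 \<le> k" "length b = k" and b: "sorted_wrt (>) b" "\<forall>x\<in>set b. x > 0"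
  obtains w where "\<And>i. i < k \<Longrightarrow> 0 < w i"
    "\<And>V. V \<in> flags k \<Longrightarrow> real k * Q_fun A b V = (\<Sum>i<k. w i * compressed_trace (V ! i))"
proof -
  obtain m where m: "k = Suc m" using k(1) by (cases k) auto
  have pos: "0 < b ! i" if "i < k" for i using b(2) k(2) that by simp
  define w where "w i = (b ! i)\<^sup>2 - (if i < m then (b ! Suc i)\<^sup>2 else 0)" for i
  show thesis
  proof
    fix i assume i: "i < k"
    show "0 < w i"
    proof (cases "i < m")
      case True
      then have "b ! Suc i < b ! i"
        using b(1) k(2) m by (auto simp: sorted_wrt_iff_nth_less)
      with True show ?thesis
        using pos[of "Suc i"] m by (simp add: w_def power_strict_mono)
    qed (use pos[OF i] in \<open>simp add: w_def\<close>)
  next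
    fix V :: "(real^'n) set list" assume V: "V \<in> flags k"
    obtain v where v: "adapted_frame b V v"
      using ex_adapted_frame[OF V, of b] pos less_imp_le by blast
    have len: "length V = k" "length v = k"
      using V v by (simp_all add: flags_def adapted_frame_def)
    define T where "T i = compressed_trace (V ! i)" for i
    have step: "(A *v (v ! i)) \<bullet> (v ! i) = (b ! i)\<^sup>2 * (T i - (if i = 0 then 0 else T (i - 1)))"
      if i: "i < k" for i
    proof -
      define U where "U = (if i = 0 then {0} else V ! (i - 1))"
      have vi: "v ! i \<in> V ! i" "norm (v ! i) = b ! i" "\<And>u. u \<in> U \<Longrightarrow> v ! i \<bullet> u = 0"
        using v i len by (auto simp: adapted_frame_def U_def orthogonal_comp_def orthogonal_def inner_commute
            split: if_splits)
      have W: "subspace (V ! i)" "dim (V ! i) = i + 1"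
        using V i by (auto simp: flags_def)
      have U: "subspace U" "U \<subseteq> V ! i" "dim U = i"
      proof -
        have "subspace U \<and> U \<subseteq> V ! i \<and> dim U = i"
        proof (cases i)
          case 0
          then show ?thesis using W(1) by (simp add: U_def subspace_0)
        next
          case (Suc j)
          then have "V ! j \<subset> V ! i" "subspace (V ! j)" "dim (V ! j) = j + 1"
            using V i by (auto simp: flags_def)
          then show ?thesis using Suc by (simp add: U_def)
        qed
        then show "subspace U" "U \<subseteq> V ! i" "dim U = i" by auto
      qed
      have "v ! i \<noteq> 0" using vi(2) pos[OF i] by auto
      then have "(v ! i \<bullet> v ! i) * (compressed_trace (V ! i) - compressed_trace U) = (A *v (v ! i)) \<bullet> (v ! i)"
        using compressed_trace_extend[OF matrix_vector_mul_linear A_eigen U(1) W(1) U(2) _ vi(1,3)] U(3) W(2)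
        by simp
      moreover have "v ! i \<bullet> v ! i = (b ! i)\<^sup>2"
        by (simp add: vi(2) flip: power2_norm_eq_inner)
      moreover have "compressed_trace U = (if i = 0 then 0 else T (i - 1))"
        by (simp add: U_def T_def compressed_trace_trivial)
      ultimately show ?thesis by (simp add: T_def)
    qed
    have "real k * Q_fun A b V = (\<Sum>i<k. (A *v (v ! i)) \<bullet> (v ! i))"
      using k(1) by (simp add: Q_fun_eq[OF V v] frame_average_def len)
    also have "\<dots> = (\<Sum>i<k. (b ! i)\<^sup>2 * (T i - (if i = 0 then 0 else T (i - 1))))"
      by (rule sum.cong) (simp_all add: step)
    also have "\<dots> = (\<Sum>i<k. w i * T i)"
      unfolding m w_def by (rule summation_by_parts)
    finally show "real k * Q_fun A b V = (\<Sum>i<k. w i * compressed_trace (V ! i))"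
      by (simp add: T_def)
  qed
qed

text \<open>The gain of the average is a positive combination of the gains of the single subspaces. These are
  nonnegative, so the average is stationary only if each subspace of the flag is.\<close>

lemma strict_lyapunov_of_eigenbasis:
  assumes "1 \<le> k" "length b = k" "sorted_wrt (>) b" "\<forall>x\<in>set b. x > 0"
  shows "strict_lyapunov_function (flags k) (flag_flow H) (Q_fun A b)"
proof -
  obtain w where w: "\<And>i. i < k \<Longrightarrow> 0 < w i"
    "\<And>V. V \<in> flags k \<Longrightarrow> real k * Q_fun A b V = (\<Sum>i<k. w i * compressed_trace (V ! i))"
    using Q_fun_positive_combination[OF assms] by blast
  have gain: "real k * (Q_fun A b (flag_flow H t V) - Q_fun A b V) =
      (\<Sum>i<k. w i * (compressed_trace (flow t ` (V ! i)) - compressed_trace (V ! i)))"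
    if V: "V \<in> flags k" for t V
  proof -
    have "length V = k" using V by (simp add: flags_def)
    then show ?thesis
      using w(2)[OF V] w(2)[OF flag_flow_flags[OF V, of H t]]
      by (simp add: right_diff_distrib sum_subtractf flag_flow_eq_flow)
  qed
  have term_nonneg: "0 \<le> w i * (compressed_trace (flow t ` (V ! i)) - compressed_trace (V ! i))"
    if "V \<in> flags k" "0 \<le> t" "i < k" for V t i
    using that w(1) compressed_trace_le_flow[of "V ! i" t] by (auto simp: flags_def less_imp_le)
  show ?thesis
    unfolding strict_lyapunov_function_def lyapunov_function_def
  proof (intro conjI ballI allI impI)
    fix V :: "(real^'n) set list" and t :: real
    assume V: "V \<in> flags k" and t: "0 \<le> t"
    have "0 \<le> real k * (Q_fun A b (flag_flow H t V) - Q_fun A b V)"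
      unfolding gain[OF V] by (intro sum_nonneg term_nonneg[OF V t]) simp
    then show "Q_fun A b V \<le> Q_fun A b (flag_flow H t V)"
      using assms(1) by (simp add: zero_le_mult_iff)
  next
    fix V :: "(real^'n) set list" and t :: real
    assume V: "V \<in> flags k" and t: "0 < t"
    show "Q_fun A b (flag_flow H t V) = Q_fun A b V \<longleftrightarrow> flag_flow H t V = V"
    proof
      assume "Q_fun A b (flag_flow H t V) = Q_fun A b V"
      then have "(\<Sum>i<k. w i * (compressed_trace (flow t ` (V ! i)) - compressed_trace (V ! i))) = 0"
        using gain[OF V, of t] by simp
      then have zero: "\<forall>i\<in>{..<k}. w i * (compressed_trace (flow t ` (V ! i)) - compressed_trace (V ! i)) = 0"
        by (subst (asm) sum_nonneg_eq_0_iff) (use term_nonneg[OF V] t in auto)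
      have "flow t ` (V ! i) = V ! i" if i: "i < k" for i
      proof (rule compressed_trace_eq_imp_invariant[OF _ t])
        show "subspace (V ! i)" using V i by (simp add: flags_def)
        show "compressed_trace (flow t ` (V ! i)) = compressed_trace (V ! i)"
          using bspec[OF zero, of i] w(1)[OF i] i by simp
      qed
      then show "flag_flow H t V = V"
        using V by (auto simp: flag_flow_eq_flow flags_def intro: nth_equalityI)
    qed simp
  qed
qed

end

lemma strict_lyapunov_subset:
  "strict_lyapunov_function F \<phi> Q \<Longrightarrow> G \<subseteq> F \<Longrightarrow> strict_lyapunov_function G \<phi> Q"
  by (auto simp: strict_lyapunov_function_def lyapunov_function_def)

lemma isotropic_flags_subset: "isotropic_flags k \<subseteq> flags k"
  by (auto simp: isotropic_flags_def)

lemma strict_lyapunov_flags: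
  fixes A H :: "real^'n^'n"
  assumes "1 \<le> k" "length b = k" "sorted_wrt (>) b" "\<forall>x\<in>set b. x > 0"
    and sym: "transpose A = A" and same: "same_ordered_eigendirections A H"
  shows "strict_lyapunov_function (flags k) (flag_flow H) (Q_fun A b)"
proof -
  obtain B \<alpha> \<eta> where "common_eigenbasis B \<alpha> \<eta> A H"
    using ex_common_eigenbasis[OF sym same] .
  then show ?thesis
    using assms(1-4) by (rule common_eigenbasis.strict_lyapunov_of_eigenbasis)
qed

theorem theoremA:
  fixes k :: nat and b :: "real list"
  assumes "1 \<le> k" and "k \<le> CARD('n::finite)"
    and "length b = k" and "sorted_wrt (>) b" and "\<forall>x\<in>set b. x > 0"
  shows "(\<forall>A \<in> sl_algebra. \<forall>H \<in> (sl_algebra :: (real^'n^'n) set).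
            transpose A = A \<longrightarrow> transpose H = H \<longrightarrow> same_ordered_eigendirections A H \<longrightarrow>
            strict_lyapunov_function (flags k) (flag_flow H) (Q_fun A b))
       \<and> (\<forall>A \<in> sp_algebra. \<forall>H \<in> (sp_algebra :: (real^('n + 'n)^('n + 'n)) set).
            transpose A = A \<longrightarrow> transpose H = H \<longrightarrow> same_ordered_eigendirections A H \<longrightarrow>
            strict_lyapunov_function (isotropic_flags k) (flag_flow H) (Q_fun A b))"
proof (intro conjI ballI impI)
  fix A H :: "real^'n^'n"
  assume "transpose A = A" "same_ordered_eigendirections A H"
  with assms(1,3,4,5) show "strict_lyapunov_function (flags k) (flag_flow H) (Q_fun A b)"
    by (rule strict_lyapunov_flags)
next
  fix A H :: "real^('n + 'n)^('n + 'n)"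
  assume "transpose A = A" "same_ordered_eigendirections A H"
  with assms(1,3,4,5) have "strict_lyapunov_function (flags k) (flag_flow H) (Q_fun A b)"
    by (rule strict_lyapunov_flags)
  then show "strict_lyapunov_function (isotropic_flags k) (flag_flow H) (Q_fun A b)"
    by (rule strict_lyapunov_subset[OF _ isotropic_flags_subset])
qed

end
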